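(* Let $l\ge 1$ and let $d_1,\dots,d_l$ be nonnegative integers with $d=d_1+\cdots+d_l\ge 1$. For $1\le k\le d$ let $\left\lfloor{\mathbf{d}\atop k}\right\rfloor_O$ denote the number of $k$-tuples $$((\sigma_1,\dots,\sigma_{i_1}),(\sigma_{i_1+1},\dots,\sigma_{i_2}),\dots,(\sigma_{i_{k-1}+1},\dots,\sigma_d))$$ where $[\sigma_1,\dots,\sigma_d]$ is a permutation of the multiset $S(\mathbf{d})$ and $0<i_1<i_2<\cdots<i_{k-1}<d$. Then, as an identity of polynomials in $x$, $$\binom{d}{d_1,d_2,\dots,d_l}\binom{x+d}{d}=\sum_{k=1}^d\left\lfloor{\mathbf{d}\atop k}\right\rfloor_O\binom{x+1}{k}.$$
   Context: For $\mathbf{d}=(d_1,\dots,d_l)$, $S(\mathbf{d})$ is the multiset containing $j$ with multiplicity $d_j$ for each $j\in\{1,\dots,l\}$; a permutation of $S(\mathbf{d})$ is a word of length $d$ in which each $j$ appears exactly $d_j$ times. Thus $\left\lfloor{\mathbf{d}\atop k}\right\rfloor_O$ (the ordered Stirling number of the third kind, or ordered Lah number, over $S(\mathbf{d})$) counts ways to write a permutation of $S(\mathbf{d})$ and cut it into $k$ nonempty consecutive blocks. $\binom{d}{d_1,\dots,d_l}$ is the multinomial coefficient. *)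

theory Defs
  imports
    "HOL-Combinatorics.Multiset_Permutations"
    "HOL-Computational_Algebra.Polynomial"
begin

definition multiset_S :: "nat \<Rightarrow> (nat \<Rightarrow> nat) \<Rightarrow> nat multiset" where
  "multiset_S l d = (\<Sum>j\<in>{1..l}. replicate_mset (d j) j)"

definition multinomial :: "nat \<Rightarrow> (nat \<Rightarrow> nat) \<Rightarrow> nat" where
  "multinomial l d = fact (\<Sum>j\<in>{1..l}. d j) div (\<Prod>j\<in>{1..l}. fact (d j))"

text \<open>
  The cut points are \<open>0 = i 0 < i 1 < \<dots> < i (k - 1) < i k = length \<sigma>\<close>. Since lists are
  indexed from 0, the block of the entries numbered \<open>i j + 1, \<dots>, i (j + 1)\<close> in 1-based
  indexing is read off at the indices \<open>i j, \<dots>, i (j + 1) - 1\<close>.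
\<close>
definition cut_word :: "nat list \<Rightarrow> (nat \<Rightarrow> nat) \<Rightarrow> nat \<Rightarrow> nat list list" where
  "cut_word \<sigma> i k = map (\<lambda>j. map (\<lambda>m. \<sigma> ! m) [i j..<i (Suc j)]) [0..<k]"

definition ordered_lah_tuples :: "nat \<Rightarrow> (nat \<Rightarrow> nat) \<Rightarrow> nat \<Rightarrow> nat list list set" where
  "ordered_lah_tuples l d k =
     {cut_word \<sigma> i k | \<sigma> i.
        \<sigma> \<in> permutations_of_multiset (multiset_S l d) \<and>
        i 0 = 0 \<and> i k = length \<sigma> \<and> (\<forall>j<k. i j < i (Suc j))}"

definition ordered_lah :: "nat \<Rightarrow> (nat \<Rightarrow> nat) \<Rightarrow> nat \<Rightarrow> nat" where
  "ordered_lah l d k = card (ordered_lah_tuples l d k)"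

text \<open>
  The binomial coefficient with a polynomial upper argument,
  \<open>p (p - 1) \<dots> (p - k + 1) / k!\<close>. The library's \<open>gchoose\<close> is only
  available over fields of characteristic 0; it is the evaluation of this polynomial.
\<close>
definition binomial_poly :: "rat poly \<Rightarrow> nat \<Rightarrow> rat poly" where
  "binomial_poly p k = smult (1 / fact k) (\<Prod>i<k. p - of_nat i)"

lemma poly_binomial_poly: "poly (binomial_poly p k) a = poly p a gchoose k"
  by (simp add: binomial_poly_def gbinomial_prod_rev poly_prod atLeast0LessThan)

end

theory Submission
  imports Defs "HOL-Computational_Algebra.Formal_Power_Series"
begin

text \<open>
  An ordered Lah tuple is a word in \<open>S(d)\<close> together with a decomposition into \<open>k\<close> nonempty
  blocks. The word can be recovered by concatenation, so the tuples are counted by the multinomial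
  coefficient times the number \<open>n - 1 choose (k - 1)\<close> of compositions of \<open>n\<close> into \<open>k\<close> parts, and the
  identity is Vandermonde's convolution for \<open>(x + 1) + (n - 1) choose n\<close>.
\<close>

text \<open>This form drops the cut points, so that counting can go by induction on the word instead
  of by index arithmetic.\<close>

definition block_decompositions :: "'a list \<Rightarrow> nat \<Rightarrow> 'a list list set" where
  "block_decompositions xs k = {xss. concat xss = xs \<and> length xss = k \<and> [] \<notin> set xss}"

lemma block_decompositions_0: "block_decompositions xs 0 = (if xs = [] then {[]} else {})"
  by (auto simp: block_decompositions_def)

lemma block_decompositions_Nil_Suc: "block_decompositions [] (Suc k) = {}"
  by (auto simp: block_decompositions_def length_Suc_conv)

text \<open>The first letter either is a block of its own or extends the first block of a
  decomposition of the rest. This is Pascal's rule at the level of sets; \<open>hd\<close> and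
  \<open>tl\<close> are harmless because there are \<open>Suc k\<close> blocks.\<close>

lemma block_decompositions_Cons_Suc:
  "block_decompositions (x # xs) (Suc k) =
     (#) [x] ` block_decompositions xs k \<union>
     (\<lambda>xss. (x # hd xss) # tl xss) ` block_decompositions xs (Suc k)"
  (is "?L = ?A \<union> ?B")
proof (intro equalityI subsetI)
  fix xss assume "xss \<in> ?L"
  then obtain ys yss where xss: "xss = (x # ys) # yss" "ys @ concat yss = xs"
      "length yss = k" "[] \<notin> set yss"
    by (auto simp: block_decompositions_def length_Suc_conv append_eq_Cons_conv)
  show "xss \<in> ?A \<union> ?B"
  proof (cases "ys = []")
    case True
    with xss show ?thesis by (auto simp: block_decompositions_def)
  next
    case False
    with xss have "ys # yss \<in> block_decompositions xs (Suc k)"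
      by (auto simp: block_decompositions_def)
    with xss show ?thesis by (intro UnI2 image_eqI[of _ _ "ys # yss"]) auto
  qed
qed (auto simp: block_decompositions_def length_Suc_conv)

lemma finite_block_decompositions: "finite (block_decompositions xs k)"
proof (induction xs arbitrary: k)
  case Nil
  show ?case by (cases k) (auto simp: block_decompositions_0 block_decompositions_Nil_Suc)
next
  case (Cons x xs)
  then show ?case
    by (cases k) (auto simp: block_decompositions_0 block_decompositions_Cons_Suc)
qed

lemma card_block_decompositions_Cons_Suc:
  "card (block_decompositions (x # xs) (Suc k)) =
     card (block_decompositions xs k) + card (block_decompositions xs (Suc k))"
proof -
  have "inj_on (\<lambda>xss. (x # hd xss) # tl xss) (block_decompositions xs (Suc k))"
    by (rule inj_on_inverseI[where g = "\<lambda>xss. tl (hd xss) # tl xss"])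
      (auto simp: block_decompositions_def length_Suc_conv)
  moreover have "(#) [x] ` block_decompositions xs k \<inter>
      (\<lambda>xss. (x # hd xss) # tl xss) ` block_decompositions xs (Suc k) = {}"
  proof -
    \<comment> \<open>The first block has exactly one letter in one image and at least two in the
      other, which separates them.\<close>
    have "hd xss \<noteq> []" if "xss \<in> block_decompositions xs (Suc k)" for xss
      using that by (cases xss) (auto simp: block_decompositions_def)
    then show ?thesis by force
  qed
  ultimately show ?thesis
    by (simp add: block_decompositions_Cons_Suc card_Un_disjoint finite_block_decompositions
        card_image)
qed

text \<open>The \<open>k\<close> cuts are chosen among the \<open>length xs\<close> gaps between
  adjacent letters of \<open>x # xs\<close>.\<close>

lemma card_block_decompositions:
  "card (block_decompositions (x # xs) (Suc k)) = length xs choose k"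
proof (induction xs arbitrary: x k)
  case Nil
  show ?case
    by (cases k) (simp_all add: card_block_decompositions_Cons_Suc block_decompositions_0
        block_decompositions_Nil_Suc)
next
  case (Cons y ys)
  show ?case
    by (subst card_block_decompositions_Cons_Suc, cases k)
      (simp_all add: Cons.IH block_decompositions_0)
qed

text \<open>Consecutive index intervals abut, so concatenation telescopes. The inequality is carried
  along because joining the intervals at \<open>i k\<close> requires it.\<close>

lemma concat_cut_word:
  assumes "\<forall>j<k. i j < i (Suc j)"
  shows "i 0 \<le> i k \<and> concat (cut_word xs i k) = map ((!) xs) [i 0..<i k]"
  using assms
proof (induction k)
  case 0
  show ?case by (simp add: cut_word_def)
next
  case (Suc k)
  then have *: "i 0 \<le> i k" "concat (cut_word xs i k) = map ((!) xs) [i 0..<i k]" "i k < i (Suc k)"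
    by auto
  have "[i 0..<i (Suc k)] = [i 0..<i k] @ [i k..<i (Suc k)]"
    using * by (metis le_add_diff_inverse less_imp_le upt_add_eq_append)
  with * show ?case by (simp add: cut_word_def)
qed

text \<open>Any list of blocks is obtained by cutting its concatenation at the partial sums of the
  block lengths.\<close>

lemma cut_word_concat:
  "cut_word (concat xss) (\<lambda>j. length (concat (take j xss))) (length xss) = xss"
proof (rule nth_equalityI)
  fix j assume "j < length (cut_word (concat xss) (\<lambda>j. length (concat (take j xss))) (length xss))"
  then have j: "j < length xss" by (simp add: cut_word_def)
  let ?a = "concat (take j xss)"
  have "concat xss = ?a @ xss ! j @ concat (drop (Suc j) xss)"
    using arg_cong[OF id_take_nth_drop[OF j], of concat] by simp
  moreover have "concat (take (Suc j) xss) = ?a @ xss ! j"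
    using j by (simp add: take_Suc_conv_app_nth)
  ultimately have "map ((!) (concat xss)) [length ?a..<length (concat (take (Suc j) xss))] = xss ! j"
    by (intro nth_equalityI) (auto simp: nth_append)
  then show "cut_word (concat xss) (\<lambda>j. length (concat (take j xss))) (length xss) ! j = xss ! j"
    using j by (simp add: cut_word_def)
qed (simp add: cut_word_def)

lemma ordered_lah_tuples_eq:
  "ordered_lah_tuples l d k =
     (\<Union>xs\<in>permutations_of_multiset (multiset_S l d). block_decompositions xs k)"
  (is "_ = ?R")
proof (intro equalityI subsetI)
  fix xss assume "xss \<in> ordered_lah_tuples l d k"
  then obtain xs i where *: "xss = cut_word xs i k" "i 0 = 0" "i k = length xs"
      "\<forall>j<k. i j < i (Suc j)" "xs \<in> permutations_of_multiset (multiset_S l d)"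
    by (auto simp: ordered_lah_tuples_def)
  then have "concat xss = xs"
    using concat_cut_word[of k i xs] by (simp add: map_nth)
  moreover have "length xss = k" "[] \<notin> set xss"
    using * by (auto simp: cut_word_def)
  ultimately show "xss \<in> ?R"
    using * by (auto simp: block_decompositions_def)
next
  fix xss assume "xss \<in> ?R"
  then have *: "concat xss \<in> permutations_of_multiset (multiset_S l d)" "length xss = k"
      "[] \<notin> set xss"
    by (auto simp: block_decompositions_def)
  define i where "i = (\<lambda>j. length (concat (take j xss)))"
  have "xss = cut_word (concat xss) i k"
    using cut_word_concat[of xss] * by (simp add: i_def)
  moreover have "i 0 = 0" "i k = length (concat xss)"
    using * by (simp_all add: i_def)
  moreover have "i j < i (Suc j)" if "j < k" for j
  proof -
    \<comment> \<open>Nonempty blocks correspond to strictly increasing cut points.\<close>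
    have "xss ! j \<noteq> []" using that * by (metis nth_mem)
    then show ?thesis using that * by (simp add: i_def take_Suc_conv_app_nth)
  qed
  ultimately show "xss \<in> ordered_lah_tuples l d k"
    using *(1) unfolding ordered_lah_tuples_def by blast
qed

lemma count_multiset_S: "count (multiset_S l d) j = (if j \<in> {1..l} then d j else 0)"
  by (simp add: multiset_S_def count_sum)

lemma size_multiset_S: "size (multiset_S l d) = (\<Sum>j\<in>{1..l}. d j)"
  by (simp add: multiset_S_def)

lemma card_permutations_multiset_S:
  "card (permutations_of_multiset (multiset_S l d)) = multinomial l d"
proof -
  have "(\<Prod>j\<in>set_mset (multiset_S l d). fact (count (multiset_S l d) j)) =
      (\<Prod>j\<in>{1..l}. fact (count (multiset_S l d) j) :: nat)"
  \<comment> \<open>Letters \<open>j\<close> with \<open>d j = 0\<close> are missing from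
    \<open>set_mset\<close>, but each contributes only the factor \<open>fact 0 = 1\<close>.\<close>
  proof (rule prod.mono_neutral_left)
    show "set_mset (multiset_S l d) \<subseteq> {1..l}"
      by (metis count_eq_zero_iff count_multiset_S subsetI)
  qed (simp_all add: not_in_iff del: count_eq_zero_iff)
  also have "\<dots> = (\<Prod>j\<in>{1..l}. fact (d j))"
    by (rule prod.cong) (simp_all add: count_multiset_S)
  finally show ?thesis
    by (simp add: card_permutations_of_multiset multinomial_def size_multiset_S)
qed

lemma ordered_lah_eq:
  assumes "(\<Sum>j\<in>{1..l}. d j) = Suc m"
  shows "ordered_lah l d (Suc k) = multinomial l d * (m choose k)"
proof -
  let ?P = "permutations_of_multiset (multiset_S l d)"
  have "card (block_decompositions xs (Suc k)) = m choose k" if "xs \<in> ?P" for xs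
  proof -
    have "length xs = Suc m"
      using length_finite_permutations_of_multiset[OF that] assms by (simp add: size_multiset_S)
    then show ?thesis
      by (auto simp: length_Suc_conv card_block_decompositions)
  qed
  moreover have "ordered_lah l d (Suc k) = (\<Sum>xs\<in>?P. card (block_decompositions xs (Suc k)))"
    unfolding ordered_lah_def ordered_lah_tuples_eq
    \<comment> \<open>Different words have disjoint sets of decompositions, since
      \<open>concat\<close> returns the word.\<close>
    by (rule card_UN_disjoint)
      (simp_all add: finite_block_decompositions, auto simp: block_decompositions_def)
  ultimately show ?thesis
    by (simp add: card_permutations_multiset_S)
qed

lemma gbinomial_add_Suc_eq_sum:
  fixes a :: "'a :: field_char_0"
  shows "a + of_nat (Suc m) gchoose Suc m = (\<Sum>k\<le>m. of_nat (m choose k) * (a + 1 gchoose Suc k))"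
proof -
  have "a + of_nat (Suc m) gchoose Suc m = (a + 1) + of_nat m gchoose Suc m"
    by (simp add: algebra_simps)
  also have "\<dots> = (\<Sum>k\<le>Suc m. (a + 1 gchoose k) * (of_nat m gchoose (Suc m - k)))"
    by (simp only: gbinomial_Vandermonde atMost_atLeast0)
  \<comment> \<open>The term for \<open>k = 0\<close> vanishes because its second factor is
    \<open>m\<close> choose \<open>Suc m\<close>.\<close>
  also have "\<dots> = (\<Sum>k\<le>m. (a + 1 gchoose Suc k) * (of_nat m gchoose (m - k)))"
    by (subst sum.atMost_Suc_shift) (simp flip: binomial_gbinomial)
  also have "\<dots> = (\<Sum>k\<le>m. of_nat (m choose k) * (a + 1 gchoose Suc k))"
    by (rule sum.cong) (simp_all add: mult.commute flip: binomial_gbinomial binomial_symmetric)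
  finally show ?thesis .
qed

theorem theorem7:
  fixes l n :: nat and d :: "nat \<Rightarrow> nat"
  assumes "l \<ge> 1"
    and "n = (\<Sum>j\<in>{1..l}. d j)"
    and "n \<ge> 1"
  shows "of_nat (multinomial l d) * binomial_poly ([:0, 1:] + of_nat n) n
       = (\<Sum>k=1..n. of_nat (ordered_lah l d k) * binomial_poly ([:0, 1:] + 1) k)"
proof -
  obtain m where m: "n = Suc m"
    using assms(3) by (cases n) auto
  \<comment> \<open>Polynomials over the infinite field of rationals are equal once they agree at
    every point, and evaluation turns \<open>binomial_poly\<close> into
    \<open>gchoose\<close>.\<close>
  have "poly (of_nat (multinomial l d) * binomial_poly ([:0, 1:] + of_nat n) n) a =
      poly (\<Sum>k=1..n. of_nat (ordered_lah l d k) * binomial_poly ([:0, 1:] + 1) k) a" for a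
  proof -
    have "poly (\<Sum>k=1..n. of_nat (ordered_lah l d k) * binomial_poly ([:0, 1:] + 1) k) a =
        (\<Sum>k=1..n. of_nat (ordered_lah l d k) * (a + 1 gchoose k))"
      by (simp add: poly_sum poly_binomial_poly)
    also have "\<dots> = (\<Sum>k\<le>m. of_nat (ordered_lah l d (Suc k)) * (a + 1 gchoose Suc k))"
      unfolding m One_nat_def sum.shift_bounds_cl_Suc_ivl atMost_atLeast0 ..
    also have "\<dots> = of_nat (multinomial l d) *
        (\<Sum>k\<le>m. of_nat (m choose k) * (a + 1 gchoose Suc k))"
      by (simp add: ordered_lah_eq[OF assms(2)[symmetric, unfolded m]] sum_distrib_left mult.assoc)
    also have "\<dots> = of_nat (multinomial l d) * (a + of_nat n gchoose n)"
      by (simp only: gbinomial_add_Suc_eq_sum m)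
    finally show ?thesis
      by (simp add: poly_binomial_poly)
  qed
  then show ?thesis
    by (simp add: poly_eq_poly_eq_iff[symmetric] fun_eq_iff)
qed

end
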